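(* Let $q\in(0,1)$ and let $a,b,c,d$ be generic complex parameters satisfying the standing assumptions of the context, with dual parameters $\tilde a,\tilde b,\tilde c,\tilde d$. Then the non-symmetric Askey--Wilson function satisfies, as meromorphic functions of $(\gamma,z)\in\mathbb{C}^*\times\mathbb{C}^*$, the symmetries $$\mathfrak{E}(\gamma;z;a,b,c,d)=\frac{(qad^{-1},qa^{-1}d^{-1};q)_\infty}{(ac,a^{-1}c;q)_\infty}\,\frac{G_{qd^{-1}}(z)}{G_c(z)}\,\mathfrak{E}(\gamma;z;a,b,qd^{-1},qc^{-1}),$$ $$\mathfrak{E}(\gamma;z;a,b,c,d)=\frac{(bc,qa^{-1}d^{-1};q)_\infty}{(ac,qb^{-1}d^{-1};q)_\infty}\,\frac{G_{q\tilde d^{-1}}(\gamma)}{G_{\tilde c}(\gamma)}\,\mathfrak{E}(\gamma;z;b,a,c,d).$$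
   Context: Notation: $\mathbb{C}^*=\mathbb{C}\setminus\{0\}$; $q\in(0,1)$ is fixed; $(x;q)_n=\prod_{j=0}^{n-1}(1-xq^j)$ for $n\in\{0,1,2,\dots\}\cup\{\infty\}$, $(x_1,\dots,x_r;q)_n=\prod_i (x_i;q)_n$; ${}_4\phi_3\left({a_1,a_2,a_3,a_4\atop b_1,b_2,b_3};q,q\right)=\sum_{k\ge0}\frac{(a_1,a_2,a_3,a_4;q)_k}{(b_1,b_2,b_3,q;q)_k}q^k$. Square roots are principal on $\mathbb{C}\setminus(-\infty,0]$ (positive on positive reals). Gaussian: $G_e(z)=1/(ez,ez^{-1};q)_\infty$ for $e\in\mathbb{C}^*$. Standing assumptions on parameters: $a,b,c,d\in\mathbb{C}^*$; $a,b,c,d,ab,ab^{-1},cd,cd^{-1}$ have real part $>0$; and $a,b,c,d$ are generic: they and their inverses are all distinct, and no denominator below vanishes identically (it suffices that $xy^{\pm1}\notin q^{\mathbb Z}$ for distinct $x,y$ among the parameters $a,b,c,d$, and $abcd^{-1}\notin q^{\mathbb Z}$). Dual parameters: $\tilde a=\sqrt{q^{-1}abcd}$, $\tilde b=ab/\tilde a$, $\tilde c=ac/\tilde a$, $\tilde d=ad/\tilde a$. When $\mathfrak{E}$ is evaluated at other parameters (e.g. $(a,b,qd^{-1},qc^{-1})$ or $(b,a,c,d)$), the dual parameters in its definition are those of the new parameters. Askey--Wilson polynomials: $E_n^+(z;a,b,c,d)={}_4\phi_3\left({q^{-n},q^{n-1}abcd,az,az^{-1}\atop ab,ac,ad};q,q\right)$,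 $n\ge0$. Put $E_n^-(z;a,b,c,d)=z^{-1}(1-az)(1-bz)E_{n-1}^+(z;qa,qb,c,d)$, $n\ge1$. Non-symmetric Askey--Wilson polynomials (normalized to be $1$ at $z=a^{-1}$): $E_0=1$ and for $n\ge1$ $$E_{-n}(z;a,b,c,d)=E_n^+(z;a,b,c,d)-\frac{(1-q^nab)(1-q^{n-1}abcd)}{q^{n-1}b(1-ab)(1-qab)(1-ac)(1-ad)}E_n^-(z;a,b,c,d),$$ $$E_{n}(z;a,b,c,d)=E_n^+(z;a,b,c,d)-\frac{a(1-q^n)(1-q^{n-1}cd)}{q^{n-1}(1-ab)(1-qab)(1-ac)(1-ad)}E_n^-(z;a,b,c,d).$$ Non-symmetric Askey--Wilson function (rank one Cherednik kernel): $$\mathfrak{E}(\gamma;z;a,b,c,d)=\frac{(bc,qad^{-1},qbd^{-1},qcd^{-1},qa^{-1}d^{-1};q)_\infty}{(qabcd^{-1};q)_\infty(qd^{-1}z,qd^{-1}z^{-1},q\tilde d^{-1}\gamma,q\tilde d^{-1}\gamma^{-1};q)_\infty}\sum_{m=0}^\infty\frac{(-1)^m(ad)^{-m}q^{\frac12m(m+1)}}{(1-ab)(1-abcd^{-1})}\frac{(ab,ac,abcd^{-1};q)_m}{(qbd^{-1},qcd^{-1},q;q)_m}$$ $$\times\Big(-ab(1-q^m)(1-q^mcd^{-1})E_{-m}(z;a,b,c,qd^{-1})E_{-m}(\gamma;\tilde a,\tilde b,\tilde c,q\tilde d^{-1})+(1-q^mab)(1-q^mabcd^{-1})E_m(z;a,b,c,qd^{-1})E_m(\gamma;\tilde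 a,\tilde b,\tilde c,q\tilde d^{-1})\Big),$$ where the first term in the big brackets is zero for $m=0$; the sum converges absolutely and uniformly on compacta of $\mathbb{C}^*\times\mathbb{C}^*$. *)

theory Defs
  imports "HOL-Analysis.Analysis"
begin

definition qpoch :: "real \<Rightarrow> complex \<Rightarrow> nat \<Rightarrow> complex" where
  "qpoch q x n = (\<Prod>j<n. 1 - x * of_real q ^ j)"

definition qpoch_inf :: "real \<Rightarrow> complex \<Rightarrow> complex" where
  "qpoch_inf q x = (\<Prod>j. 1 - x * of_real q ^ j)"

definition qpochs :: "real \<Rightarrow> complex list \<Rightarrow> nat \<Rightarrow> complex" where
  "qpochs q xs n = (\<Prod>x\<leftarrow>xs. qpoch q x n)"

definition qpochs_inf :: "real \<Rightarrow> complex list \<Rightarrow> complex" where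
  "qpochs_inf q xs = (\<Prod>x\<leftarrow>xs. qpoch_inf q x)"

text \<open>The basic hypergeometric series \<open>\<^sub>4\<phi>\<^sub>3\<close> with base \<open>q\<close> and argument \<open>q\<close>.\<close>

definition phi43 ::
  "real \<Rightarrow> complex \<Rightarrow> complex \<Rightarrow> complex \<Rightarrow> complex \<Rightarrow> complex \<Rightarrow> complex \<Rightarrow> complex \<Rightarrow> complex" where
  "phi43 q a1 a2 a3 a4 b1 b2 b3 =
     (\<Sum>k. qpochs q [a1, a2, a3, a4] k / qpochs q [b1, b2, b3, of_real q] k * of_real q ^ k)"

definition Gaussian :: "real \<Rightarrow> complex \<Rightarrow> complex \<Rightarrow> complex" where
  "Gaussian q e z = 1 / qpochs_inf q [e * z, e / z]"

definition dual_a :: "real \<Rightarrow> complex \<Rightarrow> complex \<Rightarrow> complex \<Rightarrow> complex \<Rightarrow> complex" where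
  "dual_a q a b c d = csqrt (a * b * c * d / q)"

definition dual_b :: "real \<Rightarrow> complex \<Rightarrow> complex \<Rightarrow> complex \<Rightarrow> complex \<Rightarrow> complex" where
  "dual_b q a b c d = a * b / dual_a q a b c d"

definition dual_c :: "real \<Rightarrow> complex \<Rightarrow> complex \<Rightarrow> complex \<Rightarrow> complex \<Rightarrow> complex" where
  "dual_c q a b c d = a * c / dual_a q a b c d"

definition dual_d :: "real \<Rightarrow> complex \<Rightarrow> complex \<Rightarrow> complex \<Rightarrow> complex \<Rightarrow> complex" where
  "dual_d q a b c d = a * d / dual_a q a b c d"

text \<open>The symmetric Askey--Wilson polynomials and their anti-symmetric companions (the latter are
  only used for \<open>n \<ge> 1\<close>). The exponents are integers because \<open>n - 1\<close> may be negative.\<close>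

definition AW_plus ::
  "real \<Rightarrow> nat \<Rightarrow> complex \<Rightarrow> complex \<Rightarrow> complex \<Rightarrow> complex \<Rightarrow> complex \<Rightarrow> complex" where
  "AW_plus q n z a b c d =
     phi43 q (of_real q powi (- int n)) (of_real q powi (int n - 1) * a * b * c * d) (a * z) (a / z)
       (a * b) (a * c) (a * d)"

definition AW_minus ::
  "real \<Rightarrow> nat \<Rightarrow> complex \<Rightarrow> complex \<Rightarrow> complex \<Rightarrow> complex \<Rightarrow> complex \<Rightarrow> complex" where
  "AW_minus q n z a b c d =
     1 / z * (1 - a * z) * (1 - b * z) * AW_plus q (n - 1) z (q * a) (q * b) c d"

text \<open>The non-symmetric Askey--Wilson polynomials, indexed by the integers.\<close>

definition AW_nonsym ::
  "real \<Rightarrow> int \<Rightarrow> complex \<Rightarrow> complex \<Rightarrow> complex \<Rightarrow> complex \<Rightarrow> complex \<Rightarrow> complex" where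
  "AW_nonsym q i z a b c d =
     (let n = nat \<bar>i\<bar> in
      if i = 0 then 1
      else if i < 0 then
        AW_plus q n z a b c d
        - (1 - q ^ n * a * b) * (1 - q ^ (n - 1) * a * b * c * d)
            / (q ^ (n - 1) * b * (1 - a * b) * (1 - q * a * b) * (1 - a * c) * (1 - a * d))
          * AW_minus q n z a b c d
      else
        AW_plus q n z a b c d
        - a * (1 - q ^ n) * (1 - q ^ (n - 1) * c * d)
            / (q ^ (n - 1) * (1 - a * b) * (1 - q * a * b) * (1 - a * c) * (1 - a * d))
          * AW_minus q n z a b c d)"

text \<open>The \<open>(\<gamma>, z)\<close>-dependent denominator of the non-symmetric Askey--Wilson function; its zero set
  contains the poles.\<close>

definition AW_kernel_denom ::
  "real \<Rightarrow> complex \<Rightarrow> complex \<Rightarrow> complex \<Rightarrow> complex \<Rightarrow> complex \<Rightarrow> complex \<Rightarrow> complex" where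
  "AW_kernel_denom q \<gamma> z a b c d =
     qpochs_inf q [q / d * z, q / d / z,
                   q / dual_d q a b c d * \<gamma>, q / dual_d q a b c d / \<gamma>]"

definition AW_kernel ::
  "real \<Rightarrow> complex \<Rightarrow> complex \<Rightarrow> complex \<Rightarrow> complex \<Rightarrow> complex \<Rightarrow> complex \<Rightarrow> complex" where
  "AW_kernel q \<gamma> z a b c d =
     (let a' = dual_a q a b c d; b' = dual_b q a b c d;
          c' = dual_c q a b c d; d' = dual_d q a b c d
      in qpochs_inf q [b * c, q * a / d, q * b / d, q * c / d, q / (a * d)]
         / (qpoch_inf q (q * a * b * c / d) * AW_kernel_denom q \<gamma> z a b c d)
         * (\<Sum>m. (- 1) ^ m * inverse (a * d) ^ m * q ^ (m * (m + 1) div 2)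
                / ((1 - a * b) * (1 - a * b * c / d))
              * (qpochs q [a * b, a * c, a * b * c / d] m
                 / qpochs q [q * b / d, q * c / d, of_real q] m)
              * (- a * b * (1 - q ^ m) * (1 - q ^ m * c / d)
                   * AW_nonsym q (- int m) z a b c (q / d)
                   * AW_nonsym q (- int m) \<gamma> a' b' c' (q / d')
                 + (1 - q ^ m * a * b) * (1 - q ^ m * a * b * c / d)
                   * AW_nonsym q (int m) z a b c (q / d)
                   * AW_nonsym q (int m) \<gamma> a' b' c' (q / d'))))"

text \<open>Genericity: \<open>a, b, c, d\<close> and their inverses are distinct, and no denominator vanishes
  identically in \<open>(\<gamma>, z)\<close>. The denominators free of \<open>\<gamma>\<close> and \<open>z\<close> are products of factors
  \<open>1 - x q\<^sup>n\<close> with \<open>n \<ge> 0\<close> (and of nonzero parameters), where \<open>x\<close> runs through the following list.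
  The polynomials in \<open>z\<close> contribute \<open>ab\<close>, \<open>ac\<close>, \<open>qa/d\<close>. The polynomials in \<open>\<gamma>\<close> contribute
  \<open>ab\<close>, \<open>ac\<close>, \<open>bc\<close>, because \<open>a'b' = ab\<close>, \<open>a'c' = ac\<close>, \<open>a' q/d' = bc\<close> for the dual parameters
  \<open>a', b', c', d'\<close>. The coefficients of the series contribute \<open>qb/d\<close>, \<open>qc/d\<close>, \<open>abc/d\<close>.
  These seven are permuted by the substitutions \<open>(a, b, c, d) \<mapsto> (a, b, q/d, q/c)\<close> and
  \<open>(a, b, c, d) \<mapsto> (b, a, c, d)\<close>. The last two occur in the prefactors of the two symmetries.\<close>

definition AW_generic :: "real \<Rightarrow> complex \<Rightarrow> complex \<Rightarrow> complex \<Rightarrow> complex \<Rightarrow> bool" where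
  "AW_generic q a b c d \<longleftrightarrow>
     distinct [a, b, c, d, 1 / a, 1 / b, 1 / c, 1 / d] \<and>
     (\<forall>x \<in> {a * b, a * c, b * c, q * a / d, q * b / d, q * c / d, a * b * c / d,
            c / a, q / (b * d)}.
        \<forall>n::nat. 1 - x * q ^ n \<noteq> 0)"

text \<open>The usual sufficient condition.\<close>

lemma AW_genericI:
  fixes q :: real and a b c d :: complex
  assumes "0 < q" and "distinct [a, b, c, d, 1 / a, 1 / b, 1 / c, 1 / d]"
    and prod: "\<And>x y. (x, y) \<in> {(a, b), (a, c), (a, d), (b, c), (b, d), (c, d)} \<Longrightarrow>
           \<forall>k::int. x * y \<noteq> of_real q powi k \<and> x / y \<noteq> of_real q powi k"
    and "\<forall>k::int. a * b * c / d \<noteq> of_real q powi k"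
  shows "AW_generic q a b c d"
proof -
  define Q where "Q = complex_of_real q"
  have Q0: "Q \<noteq> 0"
    using assms(1) by (simp add: Q_def)
  have reg: "1 - x * of_real q ^ n \<noteq> 0" if "\<forall>k::int. x \<noteq> Q powi k" for x and n :: nat
  proof
    assume "1 - x * of_real q ^ n = 0"
    then have "x = Q powi (- int n)"
      using Q0 by (simp add: Q_def power_int_minus field_simps)
    with that show False by blast
  qed
  have shift: "\<forall>k::int. Q * x \<noteq> Q powi k" if "\<forall>k::int. x \<noteq> Q powi k" for x
  proof (intro allI notI)
    fix k :: int
    assume "Q * x = Q powi k"
    then have "x = Q powi (k - 1)"
      using Q0 by (simp add: power_int_diff field_simps)
    with that show False by blast
  qed
  have inv: "\<forall>k::int. 1 / x \<noteq> Q powi k" if "\<forall>k::int. x \<noteq> Q powi k" for x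
  proof (intro allI notI)
    fix k :: int
    assume "1 / x = Q powi k"
    then have "x = Q powi (- k)"
      by (metis inverse_eq_divide inverse_inverse_eq power_int_minus)
    with that show False by blast
  qed
  have p: "\<forall>k::int. a * b \<noteq> Q powi k" "\<forall>k::int. a * c \<noteq> Q powi k"
    "\<forall>k::int. b * c \<noteq> Q powi k" "\<forall>k::int. b * d \<noteq> Q powi k"
    "\<forall>k::int. a / d \<noteq> Q powi k" "\<forall>k::int. b / d \<noteq> Q powi k" "\<forall>k::int. c / d \<noteq> Q powi k"
    "\<forall>k::int. a / c \<noteq> Q powi k"
    using prod[of a b] prod[of a c] prod[of b c] prod[of b d] prod[of a d] prod[of c d]
    by (auto simp: Q_def)
  have s: "\<forall>k::int. Q * a / d \<noteq> Q powi k" "\<forall>k::int. Q * b / d \<noteq> Q powi k"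
    "\<forall>k::int. Q * c / d \<noteq> Q powi k" "\<forall>k::int. c / a \<noteq> Q powi k"
    "\<forall>k::int. Q / (b * d) \<noteq> Q powi k"
    using shift[OF p(5)] shift[OF p(6)] shift[OF p(7)] inv[OF p(8)] shift[OF inv[OF p(4)]]
    by simp_all
  have r: "\<forall>k::int. a * b * c / d \<noteq> Q powi k"
    using assms(4) by (simp add: Q_def)
  note all = p(1-3)[THEN reg] s[THEN reg] r[THEN reg]
  show ?thesis
    unfolding AW_generic_def using assms(2) all by (auto simp: Q_def)
qed

end

theory Submission
  imports Defs
begin

text \<open>Both symmetries hold term by term in the defining series: up to the prefactors, the two sides are
  the same series.

  In the first symmetry the parameters \<open>c\<close> and \<open>q/d\<close> of the polynomials in \<open>z\<close> are exchanged, and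
  these polynomials are symmetric in the last two parameters. The dual parameters undergo the
  exchange of \<open>a'\<close> and \<open>b'\<close> and keep \<open>c'\<close>, \<open>d'\<close>. A non-symmetric Askey--Wilson polynomial with its
  first two parameters exchanged is the same polynomial in another normalization
  (\<open>AW_nonsym_swap_first\<close>); for the dual parameters the change of normalization is
  \<open>(cd/q)\<^sup>m (qa/d, qb/d; q)\<^sub>m / (ac, bc; q)\<^sub>m\<close>, which is what turns the coefficients of one series into
  those of the other (\<open>kernel_term_swap\<close>).

  The second symmetry is the first one for the dual parameters. The prefactor and the coefficients
  of the series depend only on products and quotients of parameters that duality preserves as a
  whole, so the function is unchanged when \<open>(\<gamma>, a', b', c', d')\<close> and \<open>(z, a, b, c, d)\<close> trade places
  (\<open>kernel_with_duals_duality\<close>). To apply this without following branches of the square root, the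
  function is studied with the dual parameters as independent arguments, subject to the algebraic
  relation \<open>dual_parameters\<close>. The principal branch matters only once: in the first symmetry the new
  dual parameter \<open>a'\<close> has to be \<open>b'\<close> and not \<open>-b'\<close>, by the conditions on the real parts
  (\<open>dual_a_swap\<close>).

  The change of normalization rests on a case of Sears' transformation of a terminating balanced
  \<open>\<^sub>4\<phi>\<^sub>3\<close> series (\<open>AW_plus_swap_first\<close>). It is proved by expanding \<open>(az, a/z; q)\<^sub>k\<close> in the functions
  \<open>(bz, b/z; q)\<^sub>j\<close> (\<open>qpoch_connection\<close>) and summing over \<open>k\<close> by the \<open>q\<close>-Saalschuetz formula
  (\<open>q_saalschuetz\<close>), which is itself a rewriting of the same expansion.\<close>

section \<open>Shifted factorials\<close>

lemma qpoch_0 [simp]: "qpoch q x 0 = 1"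
  by (simp add: qpoch_def)

lemma qpoch_Suc: "qpoch q x (Suc n) = qpoch q x n * (1 - x * of_real q ^ n)"
  by (simp add: qpoch_def)

lemma qpoch_add: "qpoch q x (m + n) = qpoch q x m * qpoch q (x * of_real q ^ m) n"
  by (induction n) (simp_all add: qpoch_Suc power_add mult_ac)

lemma qpoch_Suc_left: "qpoch q x (Suc n) = (1 - x) * qpoch q (of_real q * x) n"
  using qpoch_add[of q x 1 n] by (simp add: qpoch_Suc mult_ac)

lemma qpoch_q_nonzero:
  assumes "0 < q" "q < 1"
  shows "qpoch q (of_real q) n \<noteq> 0"
proof -
  have "1 - of_real q * of_real q ^ j \<noteq> (0::complex)" for j
  proof -
    have "q ^ Suc j < 1"
      using assms by (intro power_Suc_less_one) auto
    then have "complex_of_real (q ^ Suc j) \<noteq> of_real 1"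
      by (subst of_real_eq_iff) simp
    then show ?thesis by simp
  qed
  then show ?thesis by (simp add: qpoch_def)
qed

text \<open>The common form of the genericity conditions, equivalent to \<open>(x; q)\<^sub>\<infinity> \<noteq> 0\<close>.\<close>

definition q_regular :: "real \<Rightarrow> complex \<Rightarrow> bool" where
  "q_regular q x \<longleftrightarrow> (\<forall>n::nat. 1 - x * of_real q ^ n \<noteq> 0)"

lemma qpoch_nonzero: "q_regular q x \<Longrightarrow> qpoch q x n \<noteq> 0"
  by (simp add: q_regular_def qpoch_def)

lemma q_regular_neq_1: "q_regular q x \<Longrightarrow> 1 - x \<noteq> 0"
  unfolding q_regular_def by (metis mult.right_neutral power_0)

lemma q_regular_mult_q: "q_regular q x \<Longrightarrow> q_regular q (of_real q * x)"
  unfolding q_regular_def by (metis mult.assoc mult.commute power_Suc)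

lemma qpoch_inf_nonzero:
  assumes "0 < q" "q < 1" "q_regular q x"
  shows "qpoch_inf q x \<noteq> 0"
proof -
  have "summable (\<lambda>j. norm x * q ^ j)"
    using assms by (intro summable_mult summable_geometric) auto
  then have "summable (\<lambda>j. norm ((1 - x * of_real q ^ j) - 1))"
    using assms(1) by (simp add: norm_mult norm_power)
  then have "convergent_prod (\<lambda>j. 1 - x * of_real q ^ j)"
    by (intro abs_convergent_prod_imp_convergent_prod summable_imp_abs_convergent_prod)
  then show ?thesis
    using assms(3) unfolding qpoch_inf_def q_regular_def by (intro prodinf_nonzero) auto
qed

section \<open>The connection formula and the q-Saalschuetz sum\<close>

text \<open>For \<open>t = a/b\<close>, \<open>u = bz\<close>, \<open>v = b/z\<close> this expands \<open>(az, a/z; q)\<^sub>k\<close> in the functions \<open>(bz, b/z; q)\<^sub>j\<close>.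
  With three free variables instead it is a polynomial identity, and the \<open>q\<close>-Saalschuetz sum is
  an instance that needs no square root \<open>b\<close> of \<open>uv\<close>. It follows by induction on \<open>k\<close>: the factor
  \<open>(1 - tuq\<^sup>k)(1 - tvq\<^sup>k)\<close> is a combination of \<open>1\<close> and \<open>(1 - uq\<^sup>j)(1 - vq\<^sup>j)\<close>, so the \<open>j\<close>-th summand for
  \<open>k\<close> contributes to the \<open>j\<close>-th and the \<open>(j+1)\<close>-st summand for \<open>k + 1\<close>.\<close>

lemma qpoch_connection:
  fixes t u v :: complex
  assumes q: "0 < q" "q < 1"
  shows "qpoch q (t * u) k * qpoch q (t * v) k =
    qpoch q (of_real q) k *
    (\<Sum>j\<le>k. qpoch q (t * u * v * of_real q ^ j) (k - j) * qpoch q t (k - j) * t ^ j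
            * (qpoch q u j * qpoch q v j)
          / (qpoch q (of_real q) j * qpoch q (of_real q) (k - j)))"
proof (induction k)
  case 0
  show ?case by simp
next
  case (Suc k)
  define Q where "Q = complex_of_real q"
  define w where "w = t * u * v"
  define T where "T k j = qpoch q (w * Q ^ j) (k - j) * qpoch q t (k - j) * t ^ j
      * (qpoch q u j * qpoch q v j) / (qpoch q Q j * qpoch q Q (k - j))" for k j
  define L where "L j = T k j * ((1 - t * Q ^ (k - j)) * (1 - w * Q ^ (k + j)))" for j
  define M where "M j = T k j * (t * Q ^ (k - j) * ((1 - u * Q ^ j) * (1 - v * Q ^ j)))" for j
  have Qnz: "qpoch q Q n \<noteq> 0" for n
    unfolding Q_def by (rule qpoch_q_nonzero[OF q])
  define g where "g n = 1 - Q * Q ^ n" for n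
  have qS: "qpoch q Q (Suc n) = qpoch q Q n * g n" for n
    by (simp add: qpoch_Suc Q_def g_def)
  have fac: "g n \<noteq> 0" for n
    using Qnz[of "Suc n"] by (simp add: qS)
  have split: "T k j * ((1 - t * u * Q ^ k) * (1 - t * v * Q ^ k)) = L j + M j" if "j \<le> k" for j
  proof -
    define i where "i = k - j"
    have k: "k = i + j" using that by (simp add: i_def)
    show ?thesis
      unfolding L_def M_def w_def k distrib_left[symmetric]
      by (simp add: power_add algebra_simps)
  qed
  have lower: "L 0 = g k * T (Suc k) 0"
    using Qnz[of k] fac[of k]
    by (simp add: L_def T_def qS qpoch_Suc[of q t] qpoch_Suc[of q w] Q_def[symmetric])
  have upper: "M k = g k * T (Suc k) (Suc k)"
    using Qnz[of k] fac[of k]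
    by (simp add: M_def T_def qS qpoch_Suc[of q u] qpoch_Suc[of q v] Q_def[symmetric])
  have middle: "L (Suc j) + M j = g k * T (Suc k) (Suc j)" if "j < k" for j
  proof -
    define i where "i = k - Suc j"
    have k: "k = Suc (i + j)" using that by (simp add: i_def)
    \<comment> \<open>\<open>W\<close> is the target summand without its factor \<open>1 - w Q ^ k\<close>, which may vanish and so
      cannot be divided out.\<close>
    define W where "W = qpoch q (w * Q ^ Suc j) i * qpoch q t (Suc i) * t ^ Suc j
      * (qpoch q u (Suc j) * qpoch q v (Suc j)) / (qpoch q Q (Suc j) * qpoch q Q (Suc i))"
    have p: "qpoch q (w * Q ^ j) (Suc i) = (1 - w * Q ^ j) * qpoch q (w * Q ^ Suc j) i"
      by (simp add: qpoch_Suc_left Q_def mult_ac)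
    have s: "qpoch q (w * Q ^ Suc j) (Suc i) = qpoch q (w * Q ^ Suc j) i * (1 - w * Q ^ k)"
      by (simp add: qpoch_Suc Q_def k power_add mult_ac)
    have 1: "L (Suc j) = W * (g i * (1 - w * Q ^ (k + Suc j)))"
      using Qnz[of i] Qnz[of j] fac[of i] fac[of j]
      by (simp add: L_def T_def W_def k qS qpoch_Suc[of q t] Q_def[symmetric] mult_ac
           del: power_Suc)
    have 2: "M j = W * ((1 - w * Q ^ j) * (Q * Q ^ i) * g j)"
      using Qnz[of i] Qnz[of j] fac[of i] fac[of j]
      by (simp add: M_def T_def W_def k qS p qpoch_Suc[of q u] qpoch_Suc[of q v] Q_def[symmetric] mult_ac)
    have 3: "T (Suc k) (Suc j) = W * (1 - w * Q ^ k)"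
      unfolding T_def W_def using s by (simp add: k)
    have "g i * (1 - w * Q ^ (k + Suc j)) + (1 - w * Q ^ j) * (Q * Q ^ i) * g j
       = g k * (1 - w * Q ^ k)"
      unfolding k g_def by (simp add: power_add algebra_simps)
    then show ?thesis
      unfolding 1 2 3 by (metis distrib_left mult.left_commute)
  qed
  have "qpoch q (t * u) (Suc k) * qpoch q (t * v) (Suc k)
      = qpoch q Q k * ((\<Sum>j\<le>k. T k j) * ((1 - t * u * Q ^ k) * (1 - t * v * Q ^ k)))"
    using Suc.IH by (simp add: qpoch_Suc T_def w_def Q_def)
  also have "(\<Sum>j\<le>k. T k j) * ((1 - t * u * Q ^ k) * (1 - t * v * Q ^ k)) = (\<Sum>j\<le>k. L j + M j)"
    unfolding sum_distrib_right by (intro sum.cong refl split) simp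
  also have "\<dots> = L 0 + (\<Sum>j<k. L (Suc j) + M j) + M k"
  proof -
    have "sum L {..k} = L 0 + (\<Sum>j<k. L (Suc j))" by (rule sum.atMost_shift)
    moreover have "sum M {..k} = sum M {..<k} + M k" by (simp add: lessThan_Suc_atMost[symmetric])
    ultimately show ?thesis by (simp only: sum.distrib add_ac)
  qed
  also have "\<dots> = g k * (T (Suc k) 0 + (\<Sum>j<k. T (Suc k) (Suc j)) + T (Suc k) (Suc k))"
    by (simp add: lower upper middle sum_distrib_left distrib_left)
  also have "T (Suc k) 0 + (\<Sum>j<k. T (Suc k) (Suc j)) + T (Suc k) (Suc k) = (\<Sum>j\<le>Suc k. T (Suc k) j)"
    by (subst sum.atMost_Suc_shift) (simp add: lessThan_Suc_atMost[symmetric])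
  finally show ?case
    unfolding Q_def[symmetric] qS by (simp add: T_def w_def mult.assoc)
qed

text \<open>Reversal of the last \<open>j\<close> factors of \<open>(t; q)\<^sub>k\<close>: by the hypothesis the factor \<open>1 - tq\<^sup>k\<^sup>-\<^sup>1\<^sup>-\<^sup>m\<close> is
  \<open>-q\<^sup>-\<^sup>m X\<^sup>-\<^sup>1 (1 - Xq\<^sup>m)\<close>. The product on the right does not depend on \<open>t\<close> or \<open>X\<close>, so it cancels when
  two reversals are divided.\<close>

lemma qpoch_reverse:
  assumes "0 < q" "j \<le> k" "t * X * of_real q ^ k = of_real q"
  shows "qpoch q t k * X ^ j =
    qpoch q t (k - j) * qpoch q X j * (\<Prod>m<j. - inverse (of_real q ^ m))"
  using assms(2)
proof (induction j)
  case 0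
  show ?case by simp
next
  case (Suc j)
  define Q where "Q = complex_of_real q"
  have Q: "Q \<noteq> 0" using assms(1) by (simp add: Q_def)
  define i where "i = k - Suc j"
  have k: "k = Suc (i + j)" using Suc.prems by (simp add: i_def)
  have "t * X * Q ^ k = Q" using assms(3) by (simp add: Q_def)
  then have "(1 - t * Q ^ i) * X = - inverse (Q ^ j) * (1 - X * Q ^ j)"
    using Q unfolding k by (simp add: power_add field_simps)
  moreover have "qpoch q t k * X ^ Suc j =
     (qpoch q t i * ((1 - t * Q ^ i) * X)) * qpoch q X j * (\<Prod>m<j. - inverse (of_real q ^ m))"
    using Suc by (simp add: k qpoch_Suc Q_def mult_ac)
  ultimately show ?case
    by (simp add: k qpoch_Suc Q_def)
qed

text \<open>The connection formula with \<open>t = q\<^sup>1\<^sup>-\<^sup>N/D\<close>, \<open>u = A\<close>, \<open>v = E\<close>, where the balancing condition says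
  \<open>tuv = C\<close>: reversing \<open>(t; q)\<^sub>N\<^sub>-\<^sub>j\<close> and \<open>(q; q)\<^sub>N\<^sub>-\<^sub>j\<close> turns its summands into hypergeometric form. The
  equation for \<open>X\<close> says \<open>X = q\<^sup>-\<^sup>N\<close>.\<close>

lemma q_saalschuetz:
  fixes A C D E X :: complex
  assumes q: "0 < q" "q < 1" and "A \<noteq> 0" "D \<noteq> 0"
    and X: "X * of_real q ^ N = 1" and bal: "A * E * of_real q = C * D * of_real q ^ N"
    and C: "qpoch q C N \<noteq> 0" and D: "qpoch q D N \<noteq> 0"
  shows "(\<Sum>i\<le>N. qpoch q X i * qpoch q E i * qpoch q A i
            / (qpoch q C i * qpoch q D i * qpoch q (of_real q) i) * of_real q ^ i)
       = A ^ N * (qpoch q (C / A) N * qpoch q (D / A) N) / (qpoch q C N * qpoch q D N)"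
proof -
  define Q where "Q = complex_of_real q"
  have Q: "Q \<noteq> 0" using q by (simp add: Q_def)
  have Qnz: "qpoch q Q n \<noteq> 0" for n
    unfolding Q_def by (rule qpoch_q_nonzero[OF q])
  define t where "t = Q / (D * Q ^ N)"
  define \<rho> where "\<rho> j = (\<Prod>m<j. - inverse (complex_of_real q ^ m))" for j
  have \<rho>: "\<rho> j \<noteq> 0" for j using q by (simp add: \<rho>_def)
  have X': "X * Q ^ N = 1" and X0: "X \<noteq> 0" using X by (auto simp: Q_def)
  have revD: "qpoch q t N * D ^ j = qpoch q t (N - j) * qpoch q D j * \<rho> j" if "j \<le> N" for j
    unfolding \<rho>_def using q that Q \<open>D \<noteq> 0\<close> by (intro qpoch_reverse) (auto simp: t_def Q_def)
  have revQ: "qpoch q Q N * X ^ j = qpoch q Q (N - j) * qpoch q X j * \<rho> j" if "j \<le> N" for j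
    unfolding \<rho>_def using q that X by (intro qpoch_reverse) (auto simp: Q_def mult.assoc)
  have revA: "qpoch q (t * A) N * (D / A) ^ N = qpoch q (D / A) N * \<rho> N"
    using qpoch_reverse[of q N N "t * A" "D / A"] q Q \<open>D \<noteq> 0\<close> \<open>A \<noteq> 0\<close>
    by (simp add: \<rho>_def t_def Q_def)
  have tN: "qpoch q t N * D ^ N = qpoch q D N * \<rho> N" using revD[of N] by simp
  have t0: "qpoch q t N \<noteq> 0" using tN D \<rho>[of N] by auto
  have tAE: "t * A * E = C" and tE: "t * E = C / A"
    using bal Q \<open>D \<noteq> 0\<close> \<open>A \<noteq> 0\<close> by (auto simp: t_def Q_def field_simps)
  have tDX: "t * D = Q * X" using X' Q \<open>D \<noteq> 0\<close> by (simp add: t_def field_simps)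
  have nz: "qpoch q C j \<noteq> 0" "qpoch q D j \<noteq> 0" if "j \<le> N" for j
    using C D that qpoch_add[of q _ j "N - j"] by auto
  have summand: "qpoch q (t * A * E * Q ^ j) (N - j) * qpoch q t (N - j) * t ^ j
            * (qpoch q A j * qpoch q E j) / (qpoch q Q j * qpoch q Q (N - j))
      = qpoch q C N * qpoch q t N / qpoch q Q N *
        (qpoch q X j * qpoch q E j * qpoch q A j / (qpoch q C j * qpoch q D j * qpoch q Q j) * Q ^ j)"
    if "j \<le> N" for j
  proof -
    have "qpoch q C N = qpoch q C j * qpoch q (C * Q ^ j) (N - j)"
      using that qpoch_add[of q C j "N - j"] by (simp add: Q_def)
    then have c: "qpoch q (t * A * E * Q ^ j) (N - j) = qpoch q C N / qpoch q C j"
      using nz[OF that] by (simp add: tAE)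
    have d: "qpoch q t (N - j) = qpoch q t N * D ^ j / (qpoch q D j * \<rho> j)"
      using revD[OF that] nz[OF that] \<rho>[of j] by (simp add: field_simps)
    have "qpoch q X j \<noteq> 0"
      using revQ[OF that] Qnz[of N] X0 by auto
    then have e: "1 / qpoch q Q (N - j) = qpoch q X j * \<rho> j / (qpoch q Q N * X ^ j)"
      using revQ[OF that] Qnz[of N] Qnz[of "N - j"] X0 by (simp add: field_simps) (metis \<rho> Qnz)
    have f: "t ^ j * D ^ j = Q ^ j * X ^ j"
      by (metis power_mult_distrib tDX)
    have "qpoch q (t * A * E * Q ^ j) (N - j) * qpoch q t (N - j) * t ^ j
            * (qpoch q A j * qpoch q E j) / (qpoch q Q j * qpoch q Q (N - j))
       = qpoch q C N / qpoch q C j * (qpoch q t N * D ^ j / (qpoch q D j * \<rho> j)) * t ^ j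
            * (qpoch q A j * qpoch q E j) / qpoch q Q j * (1 / qpoch q Q (N - j))"
      unfolding c d by simp
    also have "\<dots> = qpoch q C N / qpoch q C j * (qpoch q t N / qpoch q D j)
            * (qpoch q A j * qpoch q E j) / qpoch q Q j * (qpoch q X j / qpoch q Q N)
            * ((t ^ j * D ^ j) / X ^ j)"
      unfolding e using \<rho>[of j] by (simp add: field_simps)
    also have "(t ^ j * D ^ j) / X ^ j = Q ^ j"
      unfolding f using X0 by simp
    finally show ?thesis by (simp add: mult_ac)
  qed
  have "qpoch q (t * A) N * qpoch q (C / A) N = qpoch q Q N *
     (\<Sum>j\<le>N. qpoch q C N * qpoch q t N / qpoch q Q N *
        (qpoch q X j * qpoch q E j * qpoch q A j / (qpoch q C j * qpoch q D j * qpoch q Q j) * Q ^ j))"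
    using qpoch_connection[OF q, of t A N E] unfolding tE Q_def[symmetric]
    by (simp add: summand)
  also have "\<dots> = qpoch q C N * qpoch q t N * (\<Sum>j\<le>N.
        qpoch q X j * qpoch q E j * qpoch q A j / (qpoch q C j * qpoch q D j * qpoch q Q j) * Q ^ j)"
    unfolding sum_distrib_left[symmetric] using Qnz[of N] by simp
  finally have main: "(\<Sum>j\<le>N.
        qpoch q X j * qpoch q E j * qpoch q A j / (qpoch q C j * qpoch q D j * qpoch q Q j) * Q ^ j)
     = qpoch q (t * A) N * qpoch q (C / A) N / (qpoch q C N * qpoch q t N)"
    using C t0 by (simp add: field_simps)
  have "qpoch q (t * A) N / qpoch q t N = A ^ N * qpoch q (D / A) N / qpoch q D N"
  proof -
    have "qpoch q (t * A) N * D ^ N * qpoch q D N = A ^ N * qpoch q (D / A) N * (qpoch q t N * D ^ N)"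
      using revA tN \<open>A \<noteq> 0\<close> by (simp add: field_simps)
    then show ?thesis using t0 D \<open>D \<noteq> 0\<close> by (simp add: field_simps)
  qed
  then have "qpoch q (t * A) N * qpoch q (C / A) N / (qpoch q C N * qpoch q t N)
      = A ^ N * qpoch q (D / A) N / qpoch q D N * (qpoch q (C / A) N / qpoch q C N)"
    by (metis mult.commute times_divide_times_eq)
  then show ?thesis
    unfolding Q_def[symmetric] main by (simp add: mult_ac)
qed

section \<open>Exchanging parameters of Askey--Wilson polynomials\<close>

lemma AW_plus_sum:
  assumes "0 < q"
  shows "AW_plus q n z a b c d =
    (\<Sum>k\<le>n. qpoch q (of_real q powi (- int n)) k
         * qpoch q (of_real q powi (int n - 1) * a * b * c * d) k
         / (qpoch q (a * b) k * qpoch q (a * c) k * qpoch q (a * d) k * qpoch q (of_real q) k)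
         * of_real q ^ k * (qpoch q (a * z) k * qpoch q (a / z) k))"
proof -
  have z: "qpoch q (of_real q powi (- int n)) k = 0" if "\<not> k \<le> n" for k
  proof -
    have "1 - complex_of_real q powi (- int n) * of_real q ^ n = 0"
      using assms by (simp add: power_int_minus)
    then show ?thesis
      using that unfolding qpoch_def by (intro prod_zero) auto
  qed
  show ?thesis
    unfolding AW_plus_def phi43_def
    by (subst suminf_finite[where N = "{..n}"])
       (auto simp: qpochs_def z mult_ac intro!: sum.cong)
qed

lemma AW_plus_swap_last: "AW_plus q n z a b c d = AW_plus q n z a b d c"
  by (simp add: AW_plus_def phi43_def qpochs_def mult_ac)

text \<open>A case of Sears' transformation. After the expansion of \<open>(az, a/z; q)\<^sub>k\<close> by the connection formula
  and the substitution \<open>k = j + i\<close>, the summand splits into \<open>H j * S j i\<close>, where the sum of \<open>S j i\<close> over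
  \<open>i \<le> n - j\<close> is a \<open>q\<close>-Saalschuetz sum.\<close>

lemma AW_plus_swap_first:
  fixes a b c d z :: complex
  assumes q: "0 < q" "q < 1" and nz: "a \<noteq> 0" "b \<noteq> 0" "d \<noteq> 0" "z \<noteq> 0"
    and reg: "q_regular q (a * b)" "q_regular q (a * c)" "q_regular q (a * d)"
      "q_regular q (b * c)" "q_regular q (b * d)"
  shows "AW_plus q n z a b c d =
    (a / b) ^ n * (qpoch q (b * c) n * qpoch q (b * d) n) / (qpoch q (a * c) n * qpoch q (a * d) n)
    * AW_plus q n z b a c d"
proof -
  define Q where "Q = complex_of_real q"
  define X where "X = Q powi (- int n)"
  define P where "P = Q powi (int n - 1) * a * b * c * d"
  define t where "t = a / b"
  define B where "B j = qpoch q (b * z) j * qpoch q (b / z) j" for j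
  have Q: "Q \<noteq> 0" using q by (simp add: Q_def)
  have XQ: "X * Q ^ n = 1" using Q by (simp add: X_def power_int_minus)
  have PQ: "P * Q = a * b * c * d * Q ^ n" using Q by (simp add: P_def power_int_diff)
  have Qnz: "qpoch q Q k \<noteq> 0" for k
    unfolding Q_def by (rule qpoch_q_nonzero[OF q])
  note pnz = reg[THEN qpoch_nonzero] Qnz
  define H where "H j = qpoch q X j * qpoch q P j * Q ^ j * t ^ j * B j
      / (qpoch q (a * b) j * qpoch q (a * c) j * qpoch q (a * d) j * qpoch q Q j)" for j
  define S where "S j i = qpoch q (X * Q ^ j) i * qpoch q (P * Q ^ j) i * qpoch q t i
      / (qpoch q (a * c * Q ^ j) i * qpoch q (a * d * Q ^ j) i * qpoch q Q i) * Q ^ i" for j i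
  have add: "qpoch q x (j + i) = qpoch q x j * qpoch q (x * Q ^ j) i" for x j i
    unfolding Q_def by (rule qpoch_add)
  have pnz': "qpoch q (x * Q ^ j) i \<noteq> 0" if "q_regular q x" for x i j
    using qpoch_nonzero[OF that, of "j + i"] by (auto simp: add)
  have expand: "qpoch q X k * qpoch q P k
         / (qpoch q (a * b) k * qpoch q (a * c) k * qpoch q (a * d) k * qpoch q Q k)
         * Q ^ k * (qpoch q (a * z) k * qpoch q (a / z) k) = (\<Sum>j\<le>k. H j * S j (k - j))" for k
  proof -
    have "qpoch q (a * z) k * qpoch q (a / z) k = qpoch q Q k *
      (\<Sum>j\<le>k. qpoch q (a * b * Q ^ j) (k - j) * qpoch q t (k - j) * t ^ j * B j
            / (qpoch q Q j * qpoch q Q (k - j)))"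
      using qpoch_connection[OF q, of t "b * z" k "b / z"] nz by (simp add: t_def B_def Q_def)
    then have "qpoch q X k * qpoch q P k
         / (qpoch q (a * b) k * qpoch q (a * c) k * qpoch q (a * d) k * qpoch q Q k)
         * Q ^ k * (qpoch q (a * z) k * qpoch q (a / z) k)
      = (\<Sum>j\<le>k. qpoch q X k * qpoch q P k
         / (qpoch q (a * b) k * qpoch q (a * c) k * qpoch q (a * d) k) * Q ^ k *
         (qpoch q (a * b * Q ^ j) (k - j) * qpoch q t (k - j) * t ^ j * B j
            / (qpoch q Q j * qpoch q Q (k - j))))"
      using Qnz[of k] by (subst sum_distrib_left[symmetric]) (simp add: mult_ac)
    also have "\<dots> = (\<Sum>j\<le>k. H j * S j (k - j))"
    proof (rule sum.cong)
      fix j assume "j \<in> {..k}"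
      define i where "i = k - j"
      have k: "k = j + i" using \<open>j \<in> {..k}\<close> by (simp add: i_def)
      have d1: "qpoch q (a * b * Q ^ j) i / qpoch q (a * b) k = 1 / qpoch q (a * b) j"
        using pnz(1)[of j] pnz'[OF reg(1), of j i] by (simp add: k add)
      have "qpoch q X k * qpoch q P k
         / (qpoch q (a * b) k * qpoch q (a * c) k * qpoch q (a * d) k) * Q ^ k *
         (qpoch q (a * b * Q ^ j) i * qpoch q t i * t ^ j * B j / (qpoch q Q j * qpoch q Q i))
        = (qpoch q (a * b * Q ^ j) i / qpoch q (a * b) k) * (qpoch q X k * qpoch q P k
         / (qpoch q (a * c) k * qpoch q (a * d) k) * Q ^ k *
         (qpoch q t i * t ^ j * B j / (qpoch q Q j * qpoch q Q i)))"
        by (simp add: mult_ac)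
      also have "\<dots> = H j * S j i"
        unfolding d1 by (simp add: k add H_def S_def power_add mult_ac)
      finally show "qpoch q X k * qpoch q P k
         / (qpoch q (a * b) k * qpoch q (a * c) k * qpoch q (a * d) k) * Q ^ k *
         (qpoch q (a * b * Q ^ j) (k - j) * qpoch q t (k - j) * t ^ j * B j
            / (qpoch q Q j * qpoch q Q (k - j))) = H j * S j (k - j)"
        by (simp add: i_def)
    qed simp
    finally show ?thesis .
  qed
  have inner: "(\<Sum>i\<le>n - j. S j i) = t ^ (n - j) *
      (qpoch q (b * c * Q ^ j) (n - j) * qpoch q (b * d * Q ^ j) (n - j))
      / (qpoch q (a * c * Q ^ j) (n - j) * qpoch q (a * d * Q ^ j) (n - j))" if "j \<le> n" for j
  proof -
    have Qp: "Q ^ n = Q ^ j * Q ^ (n - j)" using that by (simp add: power_add[symmetric])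
    have bal: "t * (P * Q ^ j) * Q = (a * c * Q ^ j) * (a * d * Q ^ j) * Q ^ (n - j)"
    proof -
      have "t * (P * Q ^ j) * Q = t * Q ^ j * (P * Q)" by simp
      also have "\<dots> = (a * c * Q ^ j) * (a * d * Q ^ j) * Q ^ (n - j)"
        unfolding PQ Qp using nz by (simp add: t_def)
      finally show ?thesis .
    qed
    have X: "X * Q ^ j * Q ^ (n - j) = 1" using XQ by (simp add: Qp mult.assoc)
    have e: "a * c * Q ^ j / t = b * c * Q ^ j" "a * d * Q ^ j / t = b * d * Q ^ j"
      using nz by (auto simp: t_def)
    have t: "t \<noteq> 0" "a * d * Q ^ j \<noteq> 0" using nz Q by (auto simp: t_def)
    show ?thesis
      unfolding S_def using q_saalschuetz[OF q t[unfolded Q_def] X[unfolded Q_def] bal[unfolded Q_def]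
          pnz'[OF reg(2), unfolded Q_def] pnz'[OF reg(3), unfolded Q_def]]
      unfolding Q_def[symmetric] e .
  qed
  define K where "K = t ^ n * (qpoch q (b * c) n * qpoch q (b * d) n)
    / (qpoch q (a * c) n * qpoch q (a * d) n)"
  have outer: "H j * (\<Sum>i\<le>n - j. S j i) = K * (qpoch q X j * qpoch q P j
         / (qpoch q (a * b) j * qpoch q (b * c) j * qpoch q (b * d) j * qpoch q Q j)
         * Q ^ j * B j)" if "j \<le> n" for j
  proof -
    have tn: "t ^ n = t ^ j * t ^ (n - j)" using that by (simp add: power_add[symmetric])
    have n: "qpoch q x n = qpoch q x j * qpoch q (x * Q ^ j) (n - j)" for x
      using that add[of x j "n - j"] by simp
    show ?thesis
      unfolding inner[OF that] H_def K_def n tn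
      using pnz(4)[of j] pnz(5)[of j] by (simp add: mult_ac)
  qed
  have "AW_plus q n z a b c d = (\<Sum>k\<le>n. \<Sum>j\<le>k. H j * S j (k - j))"
    unfolding AW_plus_sum[OF q(1)] expand[symmetric] X_def P_def Q_def ..
  also have "\<dots> = (\<Sum>(j, i)\<in>{(j, i). j + i \<le> n}. H j * S j i)"
    by (rule sum.triangle_reindex_eq[symmetric])
  also have "{(j, i). j + i \<le> n} = Sigma {..n} (\<lambda>j. {..n - j})"
    by auto
  also have "(\<Sum>(j, i)\<in>Sigma {..n} (\<lambda>j. {..n - j}). H j * S j i) = (\<Sum>j\<le>n. H j * (\<Sum>i\<le>n - j. S j i))"
    by (subst sum.Sigma[symmetric]) (auto simp: sum_distrib_left)
  also have "\<dots> = (\<Sum>j\<le>n. K * (qpoch q X j * qpoch q P j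
         / (qpoch q (a * b) j * qpoch q (b * c) j * qpoch q (b * d) j * qpoch q Q j)
         * Q ^ j * B j))"
    by (intro sum.cong refl outer) simp
  also have "\<dots> = K * AW_plus q n z b a c d"
    unfolding AW_plus_sum[OF q(1)] sum_distrib_left X_def P_def Q_def B_def by (simp add: mult_ac)
  finally show ?thesis unfolding K_def t_def .
qed

lemma AW_minus_swap_last: "AW_minus q n z a b c d = AW_minus q n z a b d c"
  by (simp add: AW_minus_def AW_plus_swap_last[of q _ z _ _ c])

lemma AW_nonsym_swap_last: "AW_nonsym q i z a b c d = AW_nonsym q i z a b d c"
  unfolding AW_nonsym_def Let_def
  by (simp add: AW_plus_swap_last[of q _ z _ _ c] AW_minus_swap_last[of q _ z _ _ c] mult_ac)

text \<open>The symmetric and the anti-symmetric part are rescaled by different factors \<open>\<kappa>\<close> and \<open>\<mu>\<close>, since the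
  latter contains the polynomial of index \<open>n - 1\<close> for the parameters \<open>qa, qb, c, d\<close>. The coefficient of the anti-symmetric part is not
  symmetric in \<open>a\<close> and \<open>b\<close>, and its change makes up exactly for \<open>\<mu> / \<kappa>\<close>.\<close>

lemma AW_nonsym_swap_first:
  fixes a b c d z :: complex
  assumes q: "0 < q" "q < 1" and nz: "a \<noteq> 0" "b \<noteq> 0" "d \<noteq> 0" "z \<noteq> 0"
    and reg: "q_regular q (a * b)" "q_regular q (a * c)" "q_regular q (a * d)"
      "q_regular q (b * c)" "q_regular q (b * d)"
    and n: "n = nat \<bar>i\<bar>"
  shows "AW_nonsym q i z a b c d =
    (a / b) ^ n * (qpoch q (b * c) n * qpoch q (b * d) n) / (qpoch q (a * c) n * qpoch q (a * d) n)
    * AW_nonsym q i z b a c d"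
proof (cases n)
  case 0
  then show ?thesis using n by (simp add: AW_nonsym_def)
next
  case (Suc m)
  define Q where "Q = complex_of_real q"
  have Q: "Q \<noteq> 0" using q by (simp add: Q_def)
  define \<mu> where "\<mu> = (a / b) ^ m * (qpoch q (Q * (b * c)) m * qpoch q (Q * (b * d)) m)
      / (qpoch q (Q * (a * c)) m * qpoch q (Q * (a * d)) m)"
  define \<kappa> where "\<kappa> = (a / b) ^ n * (qpoch q (b * c) n * qpoch q (b * d) n)
      / (qpoch q (a * c) n * qpoch q (a * d) n)"
  define r where "r = (1 - a * c) * (1 - a * d)"
  define s where "s = (1 - b * c) * (1 - b * d)"
  have rs: "r \<noteq> 0" "s \<noteq> 0"
    using reg(2-5)[THEN q_regular_neq_1] by (auto simp: r_def s_def)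
  have \<kappa>: "\<kappa> = \<mu> * (a / b) * s / r"
    by (simp add: \<kappa>_def \<mu>_def Suc qpoch_Suc_left r_def s_def Q_def mult_ac)
  have plus: "AW_plus q n z a b c d = \<kappa> * AW_plus q n z b a c d"
    unfolding \<kappa>_def by (rule AW_plus_swap_first[OF q nz reg])
  have minus: "AW_minus q n z a b c d = \<mu> * AW_minus q n z b a c d"
  proof -
    have regs: "q_regular q (Q * a * (Q * b))" "q_regular q (Q * a * c)" "q_regular q (Q * a * d)"
      "q_regular q (Q * b * c)" "q_regular q (Q * b * d)"
      using reg(2-5)[THEN q_regular_mult_q] reg(1)[THEN q_regular_mult_q, THEN q_regular_mult_q]
      by (simp_all add: Q_def mult_ac)
    have "AW_plus q m z (Q * a) (Q * b) c d = \<mu> * AW_plus q m z (Q * b) (Q * a) c d"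
      using AW_plus_swap_first[OF q _ _ nz(3,4) regs, of m] nz Q
      by (simp add: \<mu>_def mult_ac)
    then show ?thesis
      by (simp add: AW_minus_def Suc Q_def)
  qed
  \<comment> \<open>Comparison of the coefficients for negative (\<open>k1\<close>) and for positive index (\<open>k2\<close>); \<open>x, y, h, u, v\<close>
    stand for the factors that are symmetric in \<open>a\<close> and \<open>b\<close>.\<close>
  have k1: "x * y / (h * b * u * v * (1 - a * c) * (1 - a * d)) * (\<mu> * M)
        = \<kappa> * (x * y / (h * a * u * v * (1 - b * c) * (1 - b * d)) * M)" for x y h u v M
  proof -
    have "x * y / (h * b * u * v * (1 - a * c) * (1 - a * d)) * (\<mu> * M)
        = x * y * M / (h * u * v) * (\<mu> / (b * r))"
      by (simp add: r_def mult_ac)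
    also have "\<mu> / (b * r) = \<kappa> / (a * s)"
      using nz rs by (simp add: \<kappa> field_simps)
    finally show ?thesis by (simp add: s_def mult_ac)
  qed
  have k2: "a * x * y / (h * u * v * (1 - a * c) * (1 - a * d)) * (\<mu> * M)
        = \<kappa> * (b * x * y / (h * u * v * (1 - b * c) * (1 - b * d)) * M)" for x y h u v M
  proof -
    have "a * x * y / (h * u * v * (1 - a * c) * (1 - a * d)) * (\<mu> * M)
        = x * y * M / (h * u * v) * (a * \<mu> / r)"
      by (simp add: r_def mult_ac)
    also have "a * \<mu> / r = \<kappa> * b / s"
      using nz rs by (simp add: \<kappa> field_simps)
    finally show ?thesis by (simp add: s_def mult_ac)
  qed
  have comm: "b * a = a * b" "x * b * a = x * a * b" for x by simp_all
  have i: "i \<noteq> 0" using n Suc by auto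
  show ?thesis
  proof (cases "i < 0")
    case True
    then show ?thesis
      unfolding \<kappa>_def[symmetric] AW_nonsym_def Let_def n[symmetric] plus minus k1 comm
      by (simp only: right_diff_distrib[of \<kappa>] i if_True if_False)
  next
    case False
    then show ?thesis
      unfolding \<kappa>_def[symmetric] AW_nonsym_def Let_def n[symmetric] plus minus k2 comm
      by (simp only: right_diff_distrib[of \<kappa>] i if_True if_False)
  qed
qed

section \<open>The kernel with independent dual parameters\<close>

text \<open>Only the square of \<open>a'\<close> is prescribed, so the sign of the square root is left open. This makes the
  relation symmetric (\<open>dual_parameters_sym\<close>) for all nonzero complex parameters.\<close>

definition dual_parameters ::
  "real \<Rightarrow> complex \<Rightarrow> complex \<Rightarrow> complex \<Rightarrow> complex \<Rightarrow>
     complex \<Rightarrow> complex \<Rightarrow> complex \<Rightarrow> complex \<Rightarrow> bool" where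
  "dual_parameters q a b c d a' b' c' d' \<longleftrightarrow>
     a \<noteq> 0 \<and> b \<noteq> 0 \<and> c \<noteq> 0 \<and> d \<noteq> 0 \<and> a' \<noteq> 0 \<and>
     of_real q * a'^2 = a * b * c * d \<and>
     b' = a * b / a' \<and> c' = a * c / a' \<and> d' = a * d / a'"

definition kernel_term ::
  "real \<Rightarrow> complex \<Rightarrow> complex \<Rightarrow> complex \<Rightarrow> complex \<Rightarrow> complex \<Rightarrow> complex \<Rightarrow>
     complex \<Rightarrow> complex \<Rightarrow> complex \<Rightarrow> complex \<Rightarrow> nat \<Rightarrow> complex" where
  "kernel_term q \<gamma> z a b c d a' b' c' d' m =
     (- 1) ^ m * inverse (a * d) ^ m * q ^ (m * (m + 1) div 2)
     / ((1 - a * b) * (1 - a * b * c / d))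
     * (qpochs q [a * b, a * c, a * b * c / d] m / qpochs q [q * b / d, q * c / d, of_real q] m)
     * (- a * b * (1 - q ^ m) * (1 - q ^ m * c / d)
          * AW_nonsym q (- int m) z a b c (q / d) * AW_nonsym q (- int m) \<gamma> a' b' c' (q / d')
        + (1 - q ^ m * a * b) * (1 - q ^ m * a * b * c / d)
          * AW_nonsym q (int m) z a b c (q / d) * AW_nonsym q (int m) \<gamma> a' b' c' (q / d'))"

definition kernel_with_duals ::
  "real \<Rightarrow> complex \<Rightarrow> complex \<Rightarrow> complex \<Rightarrow> complex \<Rightarrow> complex \<Rightarrow> complex \<Rightarrow>
     complex \<Rightarrow> complex \<Rightarrow> complex \<Rightarrow> complex \<Rightarrow> complex" where
  "kernel_with_duals q \<gamma> z a b c d a' b' c' d' =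
     qpochs_inf q [b * c, q * a / d, q * b / d, q * c / d, q / (a * d)]
     / (qpoch_inf q (q * a * b * c / d)
        * qpochs_inf q [q / d * z, q / d / z, q / d' * \<gamma>, q / d' / \<gamma>])
     * (\<Sum>m. kernel_term q \<gamma> z a b c d a' b' c' d' m)"

lemma AW_kernel_eq_kernel_with_duals:
  "AW_kernel q \<gamma> z a b c d =
     kernel_with_duals q \<gamma> z a b c d
       (dual_a q a b c d) (dual_b q a b c d) (dual_c q a b c d) (dual_d q a b c d)"
  unfolding AW_kernel_def kernel_with_duals_def kernel_term_def AW_kernel_denom_def Let_def ..

lemma dual_parameters_nonzero:
  assumes "dual_parameters q a b c d a' b' c' d'"
  shows "a \<noteq> 0" "b \<noteq> 0" "c \<noteq> 0" "d \<noteq> 0" "a' \<noteq> 0" "b' \<noteq> 0" "c' \<noteq> 0" "d' \<noteq> 0"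
    and "of_real q \<noteq> (0::complex)"
  using assms by (auto simp: dual_parameters_def)

lemma dual_parameters_products:
  assumes "dual_parameters q a b c d a' b' c' d'"
  shows "a' * b' = a * b" "a' * c' = a * c" "a' * d' = a * d"
    "of_real q * a' / d' = b * c" "b' * c' = of_real q * a / d"
    "b' / d' = b / d" "c' / d' = c / d" "a' / b' = c * d / of_real q"
    "c' / a' = of_real q / (b * d)" "of_real q / (b' * d') = c / a"
proof -
  note nz = dual_parameters_nonzero[OF assms]
  have eq: "of_real q * a'^2 = a * b * c * d" and
    b: "b' = a * b / a'" and c: "c' = a * c / a'" and d: "d' = a * d / a'"
    using assms by (auto simp: dual_parameters_def)
  have a2: "a' * a' = a * b * c * d / of_real q"
    using eq nz by (simp add: power2_eq_square field_simps)
  show "a' * b' = a * b" "a' * c' = a * c" "a' * d' = a * d" "b' / d' = b / d" "c' / d' = c / d"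
    using nz by (auto simp: b c d)
  have "of_real q * a' / d' = (of_real q * a'^2) / (a * d)"
    using nz by (simp add: d power2_eq_square)
  then show "of_real q * a' / d' = b * c"
    unfolding eq using nz by simp
  show "b' * c' = of_real q * a / d" "a' / b' = c * d / of_real q"
    "c' / a' = of_real q / (b * d)" "of_real q / (b' * d') = c / a"
    using nz a2 by (simp_all add: b c d)
qed

lemma dual_parameters_sym:
  assumes "dual_parameters q a b c d a' b' c' d'"
  shows "dual_parameters q a' b' c' d' a b c d"
proof -
  note nz = dual_parameters_nonzero[OF assms] and p = dual_parameters_products[OF assms]
  have "b' * c = b * c'"
    using assms by (simp add: dual_parameters_def)
  moreover have "of_real q * a * a = b' * c' * (a' * d')"
    unfolding p using nz by simp
  ultimately show ?thesis
    unfolding dual_parameters_def using nz p by (simp add: power2_eq_square field_simps)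
qed

text \<open>The substitution of the first symmetry exchanges \<open>a'\<close> and \<open>b'\<close> and fixes \<open>c'\<close> and \<open>d'\<close>.\<close>

lemma dual_parameters_swap:
  assumes "dual_parameters q a b c d a' b' c' d'"
  shows "dual_parameters q a b (q / d) (q / c) b' a' c' d'"
proof -
  note nz = dual_parameters_nonzero[OF assms] and p = dual_parameters_products[OF assms]
  have b2: "b' * b' = of_real q * a * b / (c * d)"
  proof -
    have "a' * of_real q = b' * (c * d)" using nz p(8) by (simp add: field_simps)
    then have "b' * b' * (c * d) = of_real q * (a' * b')" by (simp add: mult_ac)
    then show ?thesis unfolding p(1) using nz by (simp add: field_simps)
  qed
  have "c' * b' = of_real q * a / d" "d' * b' = of_real q * a / c"
    using nz p(5,10) by (simp_all add: field_simps)
  then show ?thesis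
    unfolding dual_parameters_def using nz b2 p(1) by (simp add: power2_eq_square field_simps)
qed

text \<open>The quantities \<open>ab\<close>, \<open>ac\<close>, \<open>ad\<close>, \<open>b/d\<close>, \<open>c/d\<close> agree with their duals, while \<open>bc\<close> and \<open>qa/d\<close> are dual
  to each other. The coefficients of the series and the constant prefactor are built from these
  alone; the polynomials and the products depending on \<open>z\<close> and \<open>\<gamma>\<close> trade places.\<close>

lemma kernel_with_duals_duality:
  assumes "dual_parameters q a b c d a' b' c' d'"
  shows "kernel_with_duals q \<gamma> z a b c d a' b' c' d' = kernel_with_duals q z \<gamma> a' b' c' d' a b c d"
proof -
  note p = dual_parameters_products[OF assms]
  have p': "x * b' / d' = x * b / d" "x * c' / d' = x * c / d" "x * a' * b' = x * a * b"
     "x * a' * b' * c' / d' = x * a * b * c / d" for x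
  proof -
    show "x * b' / d' = x * b / d" "x * c' / d' = x * c / d" for x
      using p(6,7) by (metis times_divide_eq_right)+
    show 1: "x * a' * b' = x * a * b" for x
      using p(1) by (simp add: mult.assoc)
    show "x * a' * b' * c' / d' = x * a * b * c / d"
      unfolding 1 using p(7) by (metis times_divide_eq_right)
  qed
  have p1: "a' * b' * c' / d' = a * b * c / d"
    using p'(4)[of 1] by simp
  have terms: "kernel_term q \<gamma> z a b c d a' b' c' d' m = kernel_term q z \<gamma> a' b' c' d' a b c d m" for m
    unfolding kernel_term_def p1 p' p(1-3) by (simp add: mult_ac p(1))
  have num: "qpochs_inf q [b * c, q * a / d, q * b / d, q * c / d, q / (a * d)]
     = qpochs_inf q [b' * c', q * a' / d', q * b' / d', q * c' / d', q / (a' * d')]"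
    unfolding p p' by (simp add: qpochs_inf_def mult_ac)
  have denom: "qpoch_inf q (q * a * b * c / d)
        * qpochs_inf q [q / d * z, q / d / z, q / d' * \<gamma>, q / d' / \<gamma>]
      = qpoch_inf q (q * a' * b' * c' / d')
        * qpochs_inf q [q / d' * \<gamma>, q / d' / \<gamma>, q / d * z, q / d / z]"
    unfolding p' by (simp add: qpochs_inf_def mult_ac)
  show ?thesis
    unfolding kernel_with_duals_def num denom terms ..
qed

section \<open>The first symmetry for independent dual parameters\<close>

text \<open>The coefficients of the two series differ by \<open>(qa/d, qb/d; q)\<^sub>m / (ac, bc; q)\<^sub>m\<close> and by the change of
  \<open>(ad)\<^sup>-\<^sup>m\<close> into \<open>(qa/c)\<^sup>-\<^sup>m\<close>. Both are absorbed by the renormalization of the polynomials in \<open>\<gamma>\<close>, because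
  \<open>a'/b' = cd/q\<close>.\<close>

lemma kernel_term_swap:
  assumes q: "0 < q" "q < 1" and dual: "dual_parameters q a b c d a' b' c' d'" and \<gamma>: "\<gamma> \<noteq> 0"
    and reg: "q_regular q (a * b)" "q_regular q (a * c)" "q_regular q (b * c)"
      "q_regular q (q * a / d)" "q_regular q (q * b / d)"
  shows "kernel_term q \<gamma> z a b c d a' b' c' d' m
       = kernel_term q \<gamma> z a b (q / d) (q / c) b' a' c' d' m"
proof -
  note nz = dual_parameters_nonzero[OF dual] and p = dual_parameters_products[OF dual]
  define Q where "Q = complex_of_real q"
  have Q: "Q \<noteq> 0" using q by (simp add: Q_def)
  define C where "C = qpoch q (a * c) m * qpoch q (b * c) m"
  define E where "E = qpoch q (Q * a / d) m * qpoch q (Q * b / d) m"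
  have e: "a' * (Q / d') = b * c" "b' * (Q / d') = Q * b / d"
  proof -
    have "a' * (Q / d') = Q * a' / d'" "b' * (Q / d') = Q * (b' / d')" by simp_all
    then show "a' * (Q / d') = b * c" "b' * (Q / d') = Q * b / d"
      unfolding p(6) using p(4) by (simp_all add: Q_def)
  qed
  have nonsym: "AW_nonsym q i \<gamma> a' b' c' (Q / d')
      = (c * d / Q) ^ m * E / C * AW_nonsym q i \<gamma> b' a' c' (Q / d')" if "m = nat \<bar>i\<bar>" for i
    using AW_nonsym_swap_first[OF q, where a = a' and b = b' and c = c' and d = "Q / d'"
        and z = \<gamma> and i = i and n = m,
        unfolded p e, folded Q_def] nz \<gamma> reg that Q
    by (simp add: C_def E_def Q_def[symmetric])
  have z: "AW_nonsym q i z a b (Q / d) (Q / (Q / c)) = AW_nonsym q i z a b c (Q / d)" for i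
    using Q AW_nonsym_swap_last[of q i z a b c] by simp
  have inv: "inverse (a * (Q / c)) ^ m = inverse (a * d) ^ m * (c * d / Q) ^ m"
  proof -
    have "inverse (a * (Q / c)) = inverse (a * d) * (c * d / Q)"
      using nz Q by (simp add: field_simps)
    then show ?thesis by (simp only: power_mult_distrib)
  qed
  have par: "a * (Q / d) = Q * a / d" "x * (Q / d) / (Q / c) = x * c / d" "Q * b / (Q / c) = b * c" for x
    using nz Q by (simp_all add: mult_ac)
  have coeff: "qpochs q [a * b, Q * a / d, a * b * c / d] m / qpochs q [b * c, Q * c / d, Q] m
     = E / C * (qpochs q [a * b, a * c, a * b * c / d] m / qpochs q [Q * b / d, Q * c / d, Q] m)"
    using reg[THEN qpoch_nonzero, of m]
    by (simp add: qpochs_def E_def C_def Q_def)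
  show ?thesis
  proof -
    define w where "w = E / C"
    have nonsym': "AW_nonsym q i \<gamma> a' b' c' (Q / d')
        = (c * d / Q) ^ m * w * AW_nonsym q i \<gamma> b' a' c' (Q / d')" if "m = nat \<bar>i\<bar>" for i
      unfolding nonsym[OF that] w_def by simp
    have bracket: "u * (f * x) + v * (f * y) = f * (u * x + v * y)" for u v f x y :: complex
      by (simp add: distrib_left mult_ac)
    have neg: "AW_nonsym q (- int m) \<gamma> a' b' c' (Q / d')
        = (c * d / Q) ^ m * w * AW_nonsym q (- int m) \<gamma> b' a' c' (Q / d')"
      by (rule nonsym') simp
    have pos: "AW_nonsym q (int m) \<gamma> a' b' c' (Q / d')
        = (c * d / Q) ^ m * w * AW_nonsym q (int m) \<gamma> b' a' c' (Q / d')"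
      by (rule nonsym') simp
    show ?thesis
      unfolding kernel_term_def Q_def[symmetric] z par inv coeff w_def[symmetric] neg pos bracket
      by (simp add: mult_ac)
  qed
qed

text \<open>Since the terms agree, only the prefactors are left to compare. The quotient of Gaussians
  replaces the denominator \<open>(cz, c/z; q)\<^sub>\<infinity>\<close> by \<open>(qz/d, q/(dz); q)\<^sub>\<infinity>\<close>.\<close>

lemma kernel_with_duals_swap:
  assumes q: "0 < q" "q < 1" and dual: "dual_parameters q a b c d a' b' c' d'" and \<gamma>: "\<gamma> \<noteq> 0"
    and reg: "q_regular q (a * b)" "q_regular q (a * c)" "q_regular q (b * c)"
      "q_regular q (q * a / d)" "q_regular q (q * b / d)" "q_regular q (c / a)"
    and nz_z: "qpochs_inf q [c * z, c / z] \<noteq> 0"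
  shows "kernel_with_duals q \<gamma> z a b c d a' b' c' d'
       = qpochs_inf q [q * a / d, q / (a * d)] / qpochs_inf q [a * c, c / a]
         * (Gaussian q (q / d) z / Gaussian q c z)
         * kernel_with_duals q \<gamma> z a b (q / d) (q / c) b' a' c' d'"
proof -
  note nz = dual_parameters_nonzero[OF dual]
  define Q where "Q = complex_of_real q"
  have Q: "Q \<noteq> 0" using q by (simp add: Q_def)
  have terms: "kernel_term q \<gamma> z a b c d a' b' c' d' = kernel_term q \<gamma> z a b (q / d) (q / c) b' a' c' d'"
    using kernel_term_swap[OF q dual \<gamma> reg(1-5)] by blast
  have par: "b * (Q / d) = Q * b / d" "x * (Q / d) / (Q / c) = x * c / d" "Q * x / (Q / c) = x * c"
    "Q / (a * (Q / c)) = c / a" "Q / (Q / c) = c" for x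
    using nz Q by (simp_all add: mult_ac)
  have "qpoch_inf q (a * c) \<noteq> 0" "qpoch_inf q (c / a) \<noteq> 0"
    using qpoch_inf_nonzero[OF q] reg by auto
  then show ?thesis
    unfolding kernel_with_duals_def terms Gaussian_def Q_def[symmetric] par
    using nz_z by (simp add: qpochs_inf_def mult_ac)
qed

section \<open>The principal square root and the two symmetries\<close>

lemma dual_parameters_dual:
  assumes "0 < q" "a \<noteq> 0" "b \<noteq> 0" "c \<noteq> 0" "d \<noteq> 0"
  shows "dual_parameters q a b c d
    (dual_a q a b c d) (dual_b q a b c d) (dual_c q a b c d) (dual_d q a b c d)"
  using assms by (simp add: dual_parameters_def dual_a_def dual_b_def dual_c_def dual_d_def)

text \<open>Square roots of the right half-plane have argument less than \<open>\<pi>/4\<close> in absolute value, so products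
  and quotients of two of them stay in the right half-plane. That is how principal roots are
  multiplied below.\<close>

lemma abs_Im_csqrt_less_Re_csqrt:
  assumes "Re w > 0"
  shows "\<bar>Im (csqrt w)\<bar> < Re (csqrt w)"
proof -
  have "Re w = (Re (csqrt w))\<^sup>2 - (Im (csqrt w))\<^sup>2"
    by (metis Re_power2 power2_csqrt)
  then have "\<bar>Im (csqrt w)\<bar>\<^sup>2 < (Re (csqrt w))\<^sup>2"
    using assms by (simp del: csqrt.sel)
  then show ?thesis
    by (rule power2_less_imp_less) (rule Re_csqrt)
qed

text \<open>With \<open>s = csqrt (ab)\<close> and \<open>r = csqrt (cd)\<close>, the principal roots defining the two sides are
  \<open>sr / sqrt q\<close> for the old and \<open>s sqrt q / r\<close> for the new parameters, since both numbers have positive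
  real part.\<close>

lemma dual_a_swap:
  assumes q: "0 < q" and nz: "a \<noteq> 0" "b \<noteq> 0" "c \<noteq> 0" "d \<noteq> 0"
    and re: "Re (a * b) > 0" "Re (c * d) > 0"
  shows "dual_a q a b (q / d) (q / c) = dual_b q a b c d"
proof -
  define s where "s = csqrt (a * b)"
  define r where "r = csqrt (c * d)"
  define p where "p = complex_of_real (sqrt q)"
  have p: "p\<^sup>2 = of_real q" "p \<noteq> 0"
    using q by (auto simp: p_def simp flip: of_real_power)
  have sr: "s\<^sup>2 = a * b" "r\<^sup>2 = c * d" "s \<noteq> 0" "r \<noteq> 0"
    using nz by (auto simp: s_def r_def)
  have wedge: "\<bar>Im s\<bar> < Re s" "\<bar>Im r\<bar> < Re r"
    using re by (auto simp: s_def r_def simp del: csqrt.sel times_complex.sel intro!: abs_Im_csqrt_less_Re_csqrt)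
  have "\<bar>Im s * Im r\<bar> < Re s * Re r"
    using wedge by (simp add: abs_mult mult_strict_mono')
  then have pos: "Re (s * r) > 0" "Re (s * cnj r) > 0"
    by auto
  have "Re (s * r / p) = Re (s * r) / sqrt q"
    by (simp add: p_def)
  then have "Re (s * r / p) > 0"
    using pos q by (simp del: times_complex.sel)
  moreover have "(s * r / p)\<^sup>2 = a * b * c * d / q"
    by (simp add: power_mult_distrib power_divide p sr)
  ultimately have a': "dual_a q a b c d = s * r / p"
    unfolding dual_a_def by (intro csqrt_unique) auto
  have b': "dual_b q a b c d = s * p / r"
    unfolding dual_b_def a' using sr(1)[symmetric] sr p by (simp add: power2_eq_square)
  have "s * p / r = of_real (sqrt q / (cmod r)\<^sup>2) * (s * cnj r)"
  proof -
    have "s * p / r = p * (s / r)" by simp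
    also have "s / r = s * cnj r / (of_real (cmod r))\<^sup>2" using complex_div_cnj[of s r] by simp
    finally show ?thesis by (simp add: p_def)
  qed
  then have "Re (s * p / r) = sqrt q / (cmod r)\<^sup>2 * Re (s * cnj r)"
    by simp
  then have "Re (s * p / r) > 0"
    using pos q sr by (simp del: times_complex.sel complex_cnj)
  moreover have "(s * p / r)\<^sup>2 = a * b * (q / d) * (q / c) / q"
    using nz q by (simp add: power_mult_distrib power_divide p sr)
  ultimately show ?thesis
    unfolding b' unfolding dual_a_def by (intro csqrt_unique) auto
qed

theorem theorem7p6:
  fixes q :: real and a b c d :: complex
  assumes "0 < q" and "q < 1"
    and "a \<noteq> 0" and "b \<noteq> 0" and "c \<noteq> 0" and "d \<noteq> 0"
    and "Re a > 0" and "Re b > 0" and "Re c > 0" and "Re d > 0"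
    and "Re (a * b) > 0" and "Re (a / b) > 0" and "Re (c * d) > 0" and "Re (c / d) > 0"
    and "AW_generic q a b c d"
  shows
    "(\<forall>\<gamma> z. \<gamma> \<noteq> 0 \<longrightarrow> z \<noteq> 0 \<longrightarrow>
        AW_kernel_denom q \<gamma> z a b c d \<noteq> 0 \<longrightarrow>
        AW_kernel_denom q \<gamma> z a b (q / d) (q / c) \<noteq> 0 \<longrightarrow>
        AW_kernel q \<gamma> z a b c d =
          qpochs_inf q [q * a / d, q / (a * d)] / qpochs_inf q [a * c, c / a]
          * (Gaussian q (q / d) z / Gaussian q c z)
          * AW_kernel q \<gamma> z a b (q / d) (q / c)) \<and>
     (\<forall>\<gamma> z. \<gamma> \<noteq> 0 \<longrightarrow> z \<noteq> 0 \<longrightarrow>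
        AW_kernel_denom q \<gamma> z a b c d \<noteq> 0 \<longrightarrow>
        AW_kernel_denom q \<gamma> z b a c d \<noteq> 0 \<longrightarrow>
        AW_kernel q \<gamma> z a b c d =
          qpochs_inf q [b * c, q / (a * d)] / qpochs_inf q [a * c, q / (b * d)]
          * (Gaussian q (q / dual_d q a b c d) \<gamma> / Gaussian q (dual_c q a b c d) \<gamma>)
          * AW_kernel q \<gamma> z b a c d)"
proof -
  note q = assms(1,2) and nz = assms(3-6)
  define a' where "a' = dual_a q a b c d"
  define b' where "b' = dual_b q a b c d"
  define c' where "c' = dual_c q a b c d"
  define d' where "d' = dual_d q a b c d"
  have dual: "dual_parameters q a b c d a' b' c' d'"
    unfolding a'_def b'_def c'_def d'_def using q nz by (intro dual_parameters_dual) auto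
  note nz' = dual_parameters_nonzero[OF dual] and p = dual_parameters_products[OF dual]
  have K: "AW_kernel q \<gamma> z a b c d = kernel_with_duals q \<gamma> z a b c d a' b' c' d'" for \<gamma> z
    unfolding AW_kernel_eq_kernel_with_duals a'_def b'_def c'_def d'_def ..
  have reg: "q_regular q (a * b)" "q_regular q (a * c)" "q_regular q (b * c)"
    "q_regular q (q * a / d)" "q_regular q (q * b / d)" "q_regular q (c / a)"
    "q_regular q (q / (b * d))"
    using assms(15) by (auto simp: AW_generic_def q_regular_def)

  \<comment> \<open>The substitution \<open>(a, b, q/d, q/c)\<close> exchanges the first two dual parameters.\<close>
  have dual1: "dual_a q a b (q / d) (q / c) = b'" "dual_b q a b (q / d) (q / c) = a'"
    "dual_c q a b (q / d) (q / c) = c'" "dual_d q a b (q / d) (q / c) = d'"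
  proof -
    show *: "dual_a q a b (q / d) (q / c) = b'"
      unfolding b'_def using assms by (intro dual_a_swap) auto
    note swap = dual_parameters_swap[OF dual]
    show "dual_b q a b (q / d) (q / c) = a'" "dual_c q a b (q / d) (q / c) = c'"
      "dual_d q a b (q / d) (q / c) = d'"
      using swap unfolding dual_b_def dual_c_def dual_d_def * dual_parameters_def by simp_all
  qed
  have first: "AW_kernel q \<gamma> z a b c d =
          qpochs_inf q [q * a / d, q / (a * d)] / qpochs_inf q [a * c, c / a]
          * (Gaussian q (q / d) z / Gaussian q c z)
          * AW_kernel q \<gamma> z a b (q / d) (q / c)"
    if "\<gamma> \<noteq> 0" "AW_kernel_denom q \<gamma> z a b (q / d) (q / c) \<noteq> 0" for \<gamma> z
  proof -
    have "qpochs_inf q [c * z, c / z] \<noteq> 0"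
      using that(2) q nz by (simp add: AW_kernel_denom_def qpochs_inf_def)
    then show ?thesis
      unfolding K AW_kernel_eq_kernel_with_duals[of q \<gamma> z a b "q / d"] dual1
      using kernel_with_duals_swap[OF q dual that(1) reg(1-6)] by blast
  qed

  \<comment> \<open>The substitution \<open>(b, a, c, d)\<close> acts on the dual parameters as the first symmetry acts on the
    parameters.\<close>
  have dual2: "dual_a q b a c d = a'" "dual_b q b a c d = b'"
    "dual_c q b a c d = q / d'" "dual_d q b a c d = q / c'"
  proof -
    show *: "dual_a q b a c d = a'" by (simp add: a'_def dual_a_def mult_ac)
    show "dual_b q b a c d = b'" "dual_c q b a c d = q / d'" "dual_d q b a c d = q / c'"
      unfolding dual_b_def dual_c_def dual_d_def * using p(1,4,9) nz nz'
      by (simp_all add: field_simps)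
  qed
  have second: "AW_kernel q \<gamma> z a b c d =
          qpochs_inf q [b * c, q / (a * d)] / qpochs_inf q [a * c, q / (b * d)]
          * (Gaussian q (q / d') \<gamma> / Gaussian q c' \<gamma>)
          * AW_kernel q \<gamma> z b a c d"
    if "z \<noteq> 0" "AW_kernel_denom q \<gamma> z b a c d \<noteq> 0" for \<gamma> z
  proof -
    note sym = dual_parameters_sym[OF dual]
    have "qpochs_inf q [c' * \<gamma>, c' / \<gamma>] \<noteq> 0"
      using that(2) nz' by (simp add: AW_kernel_denom_def qpochs_inf_def dual2)
    moreover have bd: "q * b' / d' = q * b / d"
      using p(6) by (metis times_divide_eq_right)
    moreover have "q_regular q (a' * b')" "q_regular q (a' * c')" "q_regular q (b' * c')"
      "q_regular q (q * a' / d')" "q_regular q (q * b' / d')" "q_regular q (c' / a')"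
      unfolding p bd by (fact reg)+
    ultimately have "kernel_with_duals q z \<gamma> a' b' c' d' a b c d
       = qpochs_inf q [q * a' / d', q / (a' * d')] / qpochs_inf q [a' * c', c' / a']
         * (Gaussian q (q / d') \<gamma> / Gaussian q c' \<gamma>)
         * kernel_with_duals q z \<gamma> a' b' (q / d') (q / c') b a c d"
      by (intro kernel_with_duals_swap[OF q sym that(1)])
    also have "kernel_with_duals q z \<gamma> a' b' (q / d') (q / c') b a c d
       = kernel_with_duals q \<gamma> z b a c d a' b' (q / d') (q / c')"
      by (rule kernel_with_duals_duality[OF dual_parameters_swap[OF sym]])
    finally show ?thesis
      unfolding K AW_kernel_eq_kernel_with_duals[of q \<gamma> z b] dual2
        kernel_with_duals_duality[OF dual] p .
  qed
  show ?thesis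
    using first second unfolding c'_def d'_def by blast
qed

end
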